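(* Let $d\ge1$. For every nonempty list $U$ of positive integers, the number $K_U^L(\mathbf p,\mathbf t)$ is independent of $L$; write $K_U(\mathbf p,\mathbf t)$ for it. Then, for all (possibly empty) lists $U,V,L$ of positive integers and all $\mathbf p\in\mathbb N^d$, $$H_{\mathbf p}(UL)=\sum_{\mathbf t\in\mathbb N^d}K_U(\mathbf p,\mathbf t)\,H_{\mathbf t}(L)\qquad\text{and}\qquad K_{UV}=K_UK_V .$$ In particular, for $L=(\ell_1,\ldots,\ell_s)$, $$H_{\mathbf p}(L)=\sum_{\mathbf t\in\mathbb N^d}(K_{(\ell_1)}K_{(\ell_2)}\cdots K_{(\ell_s)})(\mathbf p,\mathbf t)\,H_{\mathbf t}(\varnothing).$$
   Context: $\mathbb N=\{0,1,2,\ldots\}$. Fix $d\geq1$. A state is a pair $(\mathbf p,L)$ with control $\mathbf p=(p_0,\ldots,p_{d-1})\in\mathbb N^d$ and stack $L=(\ell_1,\ldots,\ell_s)$ a finite, possibly empty, list of positive integers. Juxtaposition of lists is concatenation, and $\mathrm{nz}$ of a list deletes its zero entries. For $0\le i<d-1$ and $0\le h<p_i$ put $$T_{i,h}(\mathbf p)=(p_0,\ldots,p_{i-1},h,p_{i+1}+p_i-1-h,p_{i+2},\ldots,p_{d-1}),$$ and for $0\le h<p_{d-1}$ put $U_h(\mathbf p)=(p_0,\ldots,p_{d-2},h)$ and $\delta_h=p_{d-1}-1-h$ (for $d=1$, $U_h((p_0))=(h)$). The transitions from $(\mathbf p,L)$ are the following; differently indexed transitions are distinct even when their targets coincide. -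 Early-band moves: for each $0\le i<d-1$, $0\le h<p_i$, target $(T_{i,h}(\mathbf p),L)$. - Last-band moves: for each $0\le h<p_{d-1}$, target $(U_h(\mathbf p),\mathrm{nz}(\ell_1+\delta_h,\ell_2,\ldots,\ell_s))$, where for an empty stack $\ell_1$ is read as $0$ and the tail as empty. - Active-head moves: if $L$ is nonempty, for each $a,b\ge0$ with $a+b=\ell_1-1$, target $(\mathbf p,\mathrm{nz}(a,b,\ell_2,\ldots,\ell_s))$. $H_{\mathbf p}(L)$ is defined by $H_{\mathbf 0}(\varnothing)=1$ and, for $(\mathbf p,L)\neq(\mathbf 0,\varnothing)$, $H_{\mathbf p}(L)$ is the sum of $H_{\mathbf p'}(L')$ over all transitions from $(\mathbf p,L)$, where $(\mathbf p',L')$ is the target. (Well defined, since $p_0+\cdots+p_{d-1}+\ell_1+\cdots+\ell_s$ drops by one along each transition.) A path is a finite sequence of consecutive transitions. A state is an exposure of $L$ if its stack is exactly $L$. For a nonempty list $U$ and a list $L$, a path starting at $(\mathbf p,UL)$ is stopped (with respect to the marked suffix $L$) if it ends at an exposure of $L$ and contains no earlier exposure of $L$. $K_U^L(\mathbf p,\mathbf t)$ is the number of stopped paths from $(\mathbf p,UL)$ to $(\mathbf t,L)$. $K_\varnothing$ is the identity kernel ($1$ if $\mathbf p=\mathbf t$, else $0$). Kernels are multiplied as matrices: $(AB)(\mathbf p,\mathbf t)=\sum_{\mathbf u\in\mathbb N^d}A(\mathbf p,\mathbf u)B(\mathbf u,\mathbf t)$. *)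

theory Defs
  imports "HOL-Analysis.Infinite_Sum"
begin

definition controls :: "nat \<Rightarrow> nat list set" where
  "controls d = {p. length p = d}"

definition stacks :: "nat list set" where
  "stacks = {L. \<forall>l\<in>set L. 0 < l}"

definition nz :: "nat list \<Rightarrow> nat list" where
  "nz L = filter (\<lambda>l. l \<noteq> 0) L"

type_synonym state = "nat list \<times> nat list"

text \<open>A transition is a start state together with one of the following indices, so that
  differently indexed transitions stay distinct when their targets coincide. The dimension is the
  length of the control.\<close>

datatype move = Early nat nat | LastBand nat | Head nat nat

fun moves :: "state \<Rightarrow> move set" where
  "moves (p, L) =
     {Early i h | i h. Suc i < length p \<and> h < p ! i} \<union>
     {LastBand h | h. p \<noteq> [] \<and> h < last p} \<union>
     {Head a b | a b. L \<noteq> [] \<and> a + b + 1 = hd L}"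

fun target :: "state \<Rightarrow> move \<Rightarrow> state" where
  "target (p, L) (Early i h) = (p[i := h, Suc i := p ! Suc i + p ! i - 1 - h], L)"
| "target (p, L) (LastBand h) =
     (p[length p - 1 := h],
      nz (case L of [] \<Rightarrow> [last p - 1 - h] | l # ls \<Rightarrow> (l + (last p - 1 - h)) # ls))"
| "target (p, L) (Head a b) = (p, nz (a # b # tl L))"

fun weight :: "state \<Rightarrow> nat" where
  "weight (p, L) = sum_list p + sum_list L"

lemma sum_list_nz: "sum_list (nz L) = sum_list L"
  by (induction L) (auto simp: nz_def)

lemma weight_target:
  assumes "m \<in> moves s"
  shows "weight s = Suc (weight (target s m))"
proof -
  obtain p L where s: "s = (p, L)" by (cases s)
  show ?thesis
  proof (cases m)
    case (Early i h)
    then have i: "Suc i < length p" "h < p ! i" using assms s by auto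
    have p: "p = take i p @ p ! i # p ! Suc i # drop (Suc (Suc i)) p"
      using i by (simp add: Cons_nth_drop_Suc)
    define A B x y where "A = take i p" and "B = drop (Suc (Suc i)) p"
      and "x = p ! i" and "y = p ! Suc i"
    have l: "length A = i" using i by (simp add: A_def)
    have p': "p = A @ x # y # B" using p by (simp add: A_def B_def x_def y_def)
    have "p[i := h, Suc i := y + x - 1 - h] = A @ h # (y + x - 1 - h) # B"
      unfolding p' using l by (simp add: list_update_append)
    then have "sum_list (p[i := h, Suc i := y + x - 1 - h]) = sum_list A + h + (y + x - 1 - h) + sum_list B"
      by simp
    moreover have "sum_list p = sum_list A + x + y + sum_list B" by (simp add: p')
    moreover have "h < x" using i by (simp add: x_def)
    ultimately show ?thesis using s Early by (simp add: x_def y_def)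
  next
    case (LastBand h)
    then have h: "p \<noteq> []" "h < last p" using assms s by auto
    then obtain q x where p: "p = q @ [x]" by (metis append_butlast_last_id)
    show ?thesis using s LastBand h by (cases L) (auto simp: p sum_list_nz)
  next
    case (Head a b)
    then show ?thesis using assms s by (cases L) (auto simp: sum_list_nz)
  qed
qed

function H :: "nat list \<Rightarrow> nat list \<Rightarrow> nat" where
  "H p L = (if p = replicate (length p) 0 \<and> L = [] then 1
     else (\<Sum>m\<in>moves (p, L). H (fst (target (p, L) m)) (snd (target (p, L) m))))"
  by pat_completeness auto
termination
proof (relation "measure weight")
  fix p L :: "nat list" and m
  assume "m \<in> moves (p, L)"
  then show "((fst (target (p, L) m), snd (target (p, L) m)), (p, L)) \<in> measure weight"
    using weight_target[of m "(p, L)"] by (simp del: weight.simps)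
qed simp

declare H.simps [simp del]

text \<open>The path from \<open>s\<close> given by the list \<open>ms\<close> ends in \<open>foldl target s ms\<close>.\<close>

fun is_path :: "state \<Rightarrow> move list \<Rightarrow> bool" where
  "is_path s [] \<longleftrightarrow> True"
| "is_path s (m # ms) \<longleftrightarrow> m \<in> moves s \<and> is_path (target s m) ms"

definition stopped_paths :: "nat list \<Rightarrow> state \<Rightarrow> move list set" where
  "stopped_paths L s = {ms. is_path s ms \<and> snd (foldl target s ms) = L \<and>
     (\<forall>k<length ms. snd (foldl target s (take k ms)) \<noteq> L)}"

definition stopped_count :: "nat list \<Rightarrow> nat list \<Rightarrow> nat list \<Rightarrow> nat list \<Rightarrow> nat" where
  "stopped_count U L p t = card {ms \<in> stopped_paths L (p, U @ L). foldl target (p, U @ L) ms = (t, L)}"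

text \<open>The marked suffix is taken to be empty here; that the count does not depend on it is part
  of the theorem.\<close>

definition stopped_kernel :: "nat list \<Rightarrow> nat list \<Rightarrow> nat list \<Rightarrow> nat" where
  "stopped_kernel U p t = (if U = [] then (if p = t then 1 else 0) else stopped_count U [] p t)"

text \<open>The library assigns the value 0 to sums that do not converge. For the kernels at hand all
  sums have finite support, by \<open>finite_kernel_row\<close> and \<open>finite_kernel_prod_row\<close> below.\<close>

definition kernel_mult ::
    "nat \<Rightarrow> (nat list \<Rightarrow> nat list \<Rightarrow> nat) \<Rightarrow> (nat list \<Rightarrow> nat list \<Rightarrow> nat) \<Rightarrow> nat list \<Rightarrow> nat list \<Rightarrow> nat" where
  "kernel_mult d A B p t = (\<Sum>\<^sub>\<infinity>u\<in>controls d. A p u * B u t)"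

definition kernel_prod :: "nat \<Rightarrow> nat list \<Rightarrow> nat list \<Rightarrow> nat list \<Rightarrow> nat" where
  "kernel_prod d L = foldr (kernel_mult d) (map (\<lambda>l. stopped_kernel [l]) L) (stopped_kernel [])"

lemma finite_moves: "finite (moves s)"
proof -
  obtain p L where s: "s = (p, L)" by (cases s)
  have "{Early i h | i h. Suc i < length p \<and> h < p ! i} \<subseteq>
      (\<lambda>(i, h). Early i h) ` (SIGMA i:{..<length p}. {..<p ! i})"
    by force
  moreover have "{LastBand h | h. p \<noteq> [] \<and> h < last p} \<subseteq> LastBand ` {..<last p}"
    by auto
  moreover have "{Head a b | a b. L \<noteq> [] \<and> a + b + 1 = hd L} \<subseteq>
      (\<lambda>(a, b). Head a b) ` ({..hd L} \<times> {..hd L})"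
    by force
  ultimately show ?thesis
    unfolding s moves.simps by (intro finite_UnI; elim finite_subset; blast intro: finite_SigmaI)
qed

lemma finite_paths: "finite {ms. is_path s ms}"
proof (induction "weight s" arbitrary: s rule: less_induct)
  case less
  have "{ms. is_path s ms} \<subseteq>
      insert [] (\<Union>m\<in>moves s. (#) m ` {ms. is_path (target s m) ms})"
  proof
    fix ms assume "ms \<in> {ms. is_path s ms}"
    then show "ms \<in> insert [] (\<Union>m\<in>moves s. (#) m ` {ms. is_path (target s m) ms})"
      by (cases ms) auto
  qed
  moreover have "finite {ms. is_path (target s m) ms}" if "m \<in> moves s" for m
    using less weight_target[OF that] by simp
  ultimately show ?case
    by (elim finite_subset) (auto simp: finite_moves)
qed

lemma finite_stopped_paths: "finite (stopped_paths L s)"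
  by (rule finite_subset[OF _ finite_paths[of s]]) (auto simp: stopped_paths_def)

lemma finite_kernel_row: "finite {t. stopped_kernel U p t \<noteq> 0}"
proof (cases "U = []")
  case True
  then show ?thesis by (simp add: stopped_kernel_def)
next
  case False
  have "{t. stopped_kernel U p t \<noteq> 0} \<subseteq> (\<lambda>ms. fst (foldl target (p, U) ms)) ` stopped_paths [] (p, U)"
  proof
    fix t assume "t \<in> {t. stopped_kernel U p t \<noteq> 0}"
    then have "{ms \<in> stopped_paths [] (p, U). foldl target (p, U) ms = (t, [])} \<noteq> {}"
      using False by (auto simp: stopped_kernel_def stopped_count_def simp del: Collect_empty_eq)
    then show "t \<in> (\<lambda>ms. fst (foldl target (p, U) ms)) ` stopped_paths [] (p, U)"
      by force
  qed
  then show ?thesis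
    by (rule finite_subset) (simp add: finite_stopped_paths)
qed

lemma finite_kernel_prod_row: "finite {t. kernel_prod d L p t \<noteq> 0}"
proof (induction L arbitrary: p)
  case Nil
  then show ?case using finite_kernel_row[of "[]" p] by (simp add: kernel_prod_def)
next
  case (Cons l L)
  have eq: "kernel_prod d (l # L) p t = (\<Sum>\<^sub>\<infinity>u\<in>controls d. stopped_kernel [l] p u * kernel_prod d L u t)" for t
    by (simp add: kernel_prod_def kernel_mult_def)
  have "{t. kernel_prod d (l # L) p t \<noteq> 0} \<subseteq>
      (\<Union>u\<in>{u. stopped_kernel [l] p u \<noteq> 0}. {t. kernel_prod d L u t \<noteq> 0})"
  proof
    fix t assume "t \<in> {t. kernel_prod d (l # L) p t \<noteq> 0}"
    then have "(\<Sum>\<^sub>\<infinity>u\<in>controls d. stopped_kernel [l] p u * kernel_prod d L u t) \<noteq> 0"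
      by (simp add: eq)
    then have "\<exists>u\<in>controls d. stopped_kernel [l] p u * kernel_prod d L u t \<noteq> 0"
      by (metis (mono_tags, lifting) infsum_0)
    then show "t \<in> (\<Union>u\<in>{u. stopped_kernel [l] p u \<noteq> 0}. {t. kernel_prod d L u t \<noteq> 0})"
      by auto
  qed
  then show ?case
    by (rule finite_subset) (intro finite_UN_I finite_kernel_row Cons.IH)
qed

end

theory Submission imports Defs begin

text \<open>Everything rests on a locality property: while some part \<open>U \<noteq> []\<close> of the stack lies above a
  suffix \<open>L\<close> of positive entries, a transition touches \<open>U\<close> and the control only, and it does so
  as if \<open>L\<close> were absent (\<open>moves_append\<close>, \<open>target_append\<close>). The suffix becomes exposed exactly when
  the part above it is used up, so first-step analysis gives
  \<open>K_U(p, t) = \<Sum>m. K_U'(p', t)\<close>, summed over the moves \<open>m\<close> from \<open>(p, U)\<close> to \<open>(p', U')\<close>, a recursion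
  in which \<open>L\<close> does not occur. Induction on the weight yields the independence of \<open>L\<close>.

  With \<open>L\<close> empty, \<open>K\<close> is a Poisson kernel: \<open>K_U(p, t)\<close> counts the ways in which the walk from
  \<open>(p, U)\<close> first reaches the empty stack with control \<open>t\<close>. Hence a function \<open>F\<close> of the state whose
  value at every state with a nonempty stack is the sum of its values at the targets is recovered
  from its values on the boundary, \<open>F (p, U) = (\<Sum>\<^sub>\<infinity>t. K_U(p, t) * F (t, []))\<close>
  (\<open>harmonic_eq_kernel_sum\<close>). By locality this applies to \<open>(p, U) \<mapsto> H p (U @ L)\<close> and to
  \<open>(p, U) \<mapsto> K_(U @ V)(p, t)\<close>; their boundary values \<open>H t L\<close> and \<open>K_V(u, t)\<close> give the expansion of
  \<open>H\<close> and the product formula. Iterating the product formula along the stack gives the product over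
  single entries.\<close>

lemma nz_append: "nz (U @ L) = nz U @ nz L"
  by (simp add: nz_def)

lemma nz_stack: "L \<in> stacks \<Longrightarrow> nz L = L"
  by (induction L) (auto simp: nz_def stacks_def)

lemma target_in_controls:
  "m \<in> moves (p, L) \<Longrightarrow> p \<in> controls d \<Longrightarrow> fst (target (p, L) m) \<in> controls d"
  by (cases m) (auto simp: controls_def)

lemma moves_append: "U \<noteq> [] \<Longrightarrow> moves (p, U @ L) = moves (p, U)"
  by simp

text \<open>Zero entries may be deleted from \<open>U\<close> but not from the suffix, as that has none.\<close>

lemma target_append:
  assumes "U \<noteq> []" "L \<in> stacks"
  shows "target (p, U @ L) m = (fst (target (p, U) m), snd (target (p, U) m) @ L)"
proof -
  obtain l U' where U: "U = l # U'" using assms(1) by (cases U) auto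
  have "nz (a # b # U' @ L) = nz (a # b # U') @ L" for a b
    using nz_append[of "a # b # U'" L] nz_stack[OF assms(2)] by simp
  moreover have "nz (a # U' @ L) = nz (a # U') @ L" for a
    using nz_append[of "a # U'" L] nz_stack[OF assms(2)] by simp
  ultimately show ?thesis by (cases m) (auto simp: U)
qed

lemma stopped_paths_exposed: "stopped_paths L (p, L) = {[]}"
proof -
  have "ms = []" if "ms \<in> stopped_paths L (p, L)" for ms
    using that by (cases ms) (fastforce simp: stopped_paths_def)+
  then show ?thesis by (auto simp: stopped_paths_def)
qed

lemma Cons_in_stopped_paths:
  assumes "snd s \<noteq> L"
  shows "m # ms \<in> stopped_paths L s \<longleftrightarrow> m \<in> moves s \<and> ms \<in> stopped_paths L (target s m)"
proof -
  have "(\<forall>k<length (m # ms). snd (foldl target s (take k (m # ms))) \<noteq> L) \<longleftrightarrow>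
      (\<forall>k<length ms. snd (foldl target (target s m) (take k ms)) \<noteq> L)"
    using assms by (simp add: All_less_Suc2)
  then show ?thesis unfolding stopped_paths_def by auto
qed

lemma stopped_count_Nil: "stopped_count [] L p t = (if p = t then 1 else 0)"
proof -
  have "{ms \<in> stopped_paths L (p, L). foldl target (p, L) ms = (t, L)} = (if p = t then {[]} else {})"
    by (auto simp: stopped_paths_exposed)
  then show ?thesis by (simp add: stopped_count_def)
qed

text \<open>First-step analysis: a stopped path that does not start at an exposure is a move followed by a
  stopped path from its target, and locality describes that target.\<close>

lemma stopped_count_step:
  assumes "U \<noteq> []" "L \<in> stacks"
  shows "stopped_count U L p t =
    (\<Sum>m\<in>moves (p, U). stopped_count (snd (target (p, U) m)) L (fst (target (p, U) m)) t)"
proof -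
  define s where "s = (p, U @ L)"
  define S where "S = (\<lambda>s. {ms \<in> stopped_paths L s. foldl target s ms = (t, L)})"
  have ne: "snd s \<noteq> L" using assms(1) by (simp add: s_def)
  have "ms \<in> S s \<longleftrightarrow> ms \<in> (\<Union>m\<in>moves s. (#) m ` S (target s m))" for ms
  proof (cases ms)
    case Nil
    then show ?thesis using ne by (auto simp: S_def)
  next
    case (Cons m ms')
    then show ?thesis by (auto simp: S_def Cons_in_stopped_paths[OF ne])
  qed
  then have "S s = (\<Union>m\<in>moves s. (#) m ` S (target s m))" by blast
  moreover have "finite (S s')" for s'
    by (simp add: S_def finite_stopped_paths)
  ultimately have "card (S s) = (\<Sum>m\<in>moves s. card ((#) m ` S (target s m)))"
    by (simp only:) (rule card_UN_disjoint, auto simp: finite_moves)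
  also have "\<dots> = (\<Sum>m\<in>moves (p, U). card (S (target s m)))"
    by (simp only: s_def moves_append[OF assms(1)]) (simp add: card_image)
  finally show ?thesis
    by (simp add: stopped_count_def S_def s_def target_append[OF assms] del: moves.simps)
qed

theorem stopped_count_suffix_independent:
  assumes "L \<in> stacks" "L' \<in> stacks"
  shows "stopped_count U L p t = stopped_count U L' p t"
proof (induction "weight (p, U)" arbitrary: p U rule: less_induct)
  case less
  show ?case
  proof (cases "U = []")
    case True
    then show ?thesis by (simp add: stopped_count_Nil)
  next
    case False
    have "stopped_count (snd (target (p, U) m)) L (fst (target (p, U) m)) t =
        stopped_count (snd (target (p, U) m)) L' (fst (target (p, U) m)) t"
      if "m \<in> moves (p, U)" for m
      using less weight_target[OF that] by (simp del: weight.simps)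
    then show ?thesis
      using False assms by (simp add: stopped_count_step cong: sum.cong del: moves.simps)
  qed
qed

lemma Nil_in_stacks: "[] \<in> stacks"
  by (simp add: stacks_def)

lemma stopped_kernel_eq_count: "stopped_kernel U p t = stopped_count U [] p t"
  by (simp add: stopped_kernel_def stopped_count_Nil)

lemma stopped_kernel_step:
  assumes "U \<noteq> []"
  shows "stopped_kernel U p t =
    (\<Sum>m\<in>moves (p, U). stopped_kernel (snd (target (p, U) m)) (fst (target (p, U) m)) t)"
  unfolding stopped_kernel_eq_count by (rule stopped_count_step[OF assms Nil_in_stacks])

lemma summable_kernel_row: "(\<lambda>t. stopped_kernel U p t * g t) summable_on A"
  by (rule finite_nonzero_values_imp_summable_on, rule finite_subset[OF _ finite_kernel_row[of U p]]) auto

lemma infsum_sum_swap: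
  fixes f :: "'a \<Rightarrow> 'b \<Rightarrow> 'c::{topological_comm_monoid_add, t2_space}"
  assumes "\<And>i. i \<in> I \<Longrightarrow> f i summable_on A"
  shows "(\<Sum>\<^sub>\<infinity>x\<in>A. \<Sum>i\<in>I. f i x) = (\<Sum>i\<in>I. \<Sum>\<^sub>\<infinity>x\<in>A. f i x)"
proof -
  have "((\<lambda>x. \<Sum>i\<in>I. f i x) has_sum (\<Sum>i\<in>I. \<Sum>\<^sub>\<infinity>x\<in>A. f i x)) A"
    using assms
    by (induction I rule: infinite_finite_induct) (auto intro!: has_sum_add has_sum_infsum)
  then show ?thesis by (rule infsumI)
qed

text \<open>The Poisson representation. Both sides satisfy the same recursion on nonempty stacks, and on
  the empty stack the kernel is the identity.\<close>

theorem harmonic_eq_kernel_sum: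
  fixes F :: "state \<Rightarrow> nat"
  assumes harmonic: "\<And>p U. U \<noteq> [] \<Longrightarrow> F (p, U) = (\<Sum>m\<in>moves (p, U). F (target (p, U) m))"
    and "p \<in> controls d"
  shows "F (p, U) = (\<Sum>\<^sub>\<infinity>t\<in>controls d. stopped_kernel U p t * F (t, []))"
  using assms(2)
proof (induction "weight (p, U)" arbitrary: p U rule: less_induct)
  case less
  show ?case
  proof (cases "U = []")
    case True
    have "(\<Sum>\<^sub>\<infinity>t\<in>controls d. stopped_kernel [] p t * F (t, [])) =
        (\<Sum>\<^sub>\<infinity>t\<in>{p}. stopped_kernel [] p t * F (t, []))"
      using less.prems by (intro infsum_cong_neutral) (auto simp: stopped_kernel_def)
    then show ?thesis by (simp add: True stopped_kernel_def)
  next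
    case False
    define K where "K = (\<lambda>m. stopped_kernel (snd (target (p, U) m)) (fst (target (p, U) m)))"
    have "F (target (p, U) m) = (\<Sum>\<^sub>\<infinity>t\<in>controls d. K m t * F (t, []))"
      if "m \<in> moves (p, U)" for m
      using less.hyps[of "fst (target (p, U) m)" "snd (target (p, U) m)"]
        weight_target[OF that] target_in_controls[OF that less.prems]
      by (simp add: K_def del: weight.simps)
    then have "F (p, U) = (\<Sum>m\<in>moves (p, U). \<Sum>\<^sub>\<infinity>t\<in>controls d. K m t * F (t, []))"
      using harmonic[OF False] by (simp cong: sum.cong del: moves.simps)
    also have "\<dots> = (\<Sum>\<^sub>\<infinity>t\<in>controls d. \<Sum>m\<in>moves (p, U). K m t * F (t, []))"
      by (rule infsum_sum_swap[symmetric]) (simp add: K_def summable_kernel_row)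
    also have "\<dots> = (\<Sum>\<^sub>\<infinity>t\<in>controls d. stopped_kernel U p t * F (t, []))"
      by (simp only: stopped_kernel_step[OF False] K_def sum_distrib_right)
    finally show ?thesis .
  qed
qed

theorem H_append:
  assumes "L \<in> stacks" "p \<in> controls d"
  shows "H p (U @ L) = (\<Sum>\<^sub>\<infinity>t\<in>controls d. stopped_kernel U p t * H t L)"
proof -
  define F :: "state \<Rightarrow> nat" where "F = (\<lambda>(p, U). H p (U @ L))"
  have "F (p, U) = (\<Sum>m\<in>moves (p, U). F (target (p, U) m))" if "U \<noteq> []" for p U
    using that H.simps[of p "U @ L"]
    by (simp add: F_def case_prod_beta moves_append target_append[OF that assms(1)] del: moves.simps)
  then show ?thesis
    using harmonic_eq_kernel_sum[of F p d U] assms(2) by (simp add: F_def)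
qed

theorem stopped_kernel_append:
  assumes "V \<in> stacks" "p \<in> controls d"
  shows "stopped_kernel (U @ V) p t = kernel_mult d (stopped_kernel U) (stopped_kernel V) p t"
proof -
  define F :: "state \<Rightarrow> nat" where "F = (\<lambda>(p, U). stopped_kernel (U @ V) p t)"
  have "F (p, U) = (\<Sum>m\<in>moves (p, U). F (target (p, U) m))" if "U \<noteq> []" for p U
    using that stopped_kernel_step[of "U @ V" p t]
    by (simp add: F_def case_prod_beta moves_append target_append[OF that assms(1)] del: moves.simps)
  then show ?thesis
    using harmonic_eq_kernel_sum[of F p d U] assms(2) by (simp add: F_def kernel_mult_def)
qed

lemma kernel_prod_eq_stopped_kernel:
  assumes "L \<in> stacks" "p \<in> controls d"
  shows "kernel_prod d L p t = stopped_kernel L p t"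
  using assms
proof (induction L arbitrary: p)
  case Nil
  then show ?case by (simp add: kernel_prod_def)
next
  case (Cons l L)
  then have L: "L \<in> stacks" by (simp add: stacks_def)
  have "kernel_prod d (l # L) p t =
      (\<Sum>\<^sub>\<infinity>u\<in>controls d. stopped_kernel [l] p u * kernel_prod d L u t)"
    by (simp add: kernel_prod_def kernel_mult_def)
  also have "\<dots> = (\<Sum>\<^sub>\<infinity>u\<in>controls d. stopped_kernel [l] p u * stopped_kernel L u t)"
    by (rule infsum_cong) (simp add: Cons.IH[OF L])
  also have "\<dots> = stopped_kernel ([l] @ L) p t"
    by (simp only: stopped_kernel_append[OF L Cons.prems(2)] kernel_mult_def)
  finally show ?case by simp
qed

theorem H_eq_kernel_prod:
  assumes "L \<in> stacks" "p \<in> controls d"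
  shows "H p L = (\<Sum>\<^sub>\<infinity>t\<in>controls d. kernel_prod d L p t * H t [])"
  using H_append[OF Nil_in_stacks assms(2), of L] kernel_prod_eq_stopped_kernel[OF assms] by simp

theorem corollary5p1:
  fixes d :: nat
  assumes "d \<ge> 1"
  shows "(\<forall>U\<in>stacks. U \<noteq> [] \<longrightarrow>
           (\<forall>p\<in>controls d. \<forall>t\<in>controls d. \<forall>L\<in>stacks. \<forall>L'\<in>stacks.
              stopped_count U L p t = stopped_count U L' p t)) \<and>
         (\<forall>U\<in>stacks. \<forall>L\<in>stacks. \<forall>p\<in>controls d.
            H p (U @ L) = (\<Sum>\<^sub>\<infinity>t\<in>controls d. stopped_kernel U p t * H t L)) \<and>
         (\<forall>U\<in>stacks. \<forall>V\<in>stacks. \<forall>p\<in>controls d. \<forall>t\<in>controls d.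
            stopped_kernel (U @ V) p t = kernel_mult d (stopped_kernel U) (stopped_kernel V) p t) \<and>
         (\<forall>L\<in>stacks. \<forall>p\<in>controls d.
            H p L = (\<Sum>\<^sub>\<infinity>t\<in>controls d. kernel_prod d L p t * H t []))"
  using stopped_count_suffix_independent H_append stopped_kernel_append H_eq_kernel_prod
  by blast

end
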